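(* Let $G=(V,E)$ be a simple graph with $n$ vertices, let $X_G=\sum_{\lambda\vdash n}c_\lambda\,\mathfrak{st}_\lambda$ be the expansion of its chromatic symmetric function in the star basis, and fix a vertex $v\in V$. Then $c_n$, the coefficient of $\mathfrak{st}_n$, is equal to the number of acyclic orientations of $G$ with unique sink $v$.
   Context: For a finite simple graph $G=(V,E)$, a proper colouring is a function $\kappa:V\to\{1,2,3,\ldots\}$ with $\kappa(u)\neq\kappa(v)$ whenever $\{u,v\}\in E$. The chromatic symmetric function of $G$ is $X_G=\sum_{\kappa\text{ proper}}\prod_{v\in V}x_{\kappa(v)}$, a symmetric function in commuting variables $x_1,x_2,\ldots$, homogeneous of degree $|V|$. The star $\mathrm{St}_k$ is the $k$-vertex tree in which $k-1$ leaves are joined to a single central vertex ($\mathrm{St}_1$ is a single vertex). For a partition $\lambda=(\lambda_1,\ldots,\lambda_\ell)$ of $n$, $\mathrm{St}_\lambda$ is the disjoint union of $\mathrm{St}_{\lambda_1},\ldots,\mathrm{St}_{\lambda_\ell}$, and $\mathfrak{st}_\lambda=X_{\mathrm{St}_\lambda}$; $\mathfrak{st}_n$ corresponds to the one-part partition $n$. It is known that $\{\mathfrak{st}_\lambda:\lambda\vdash n\}$ is a basis (over $\mathbb{Q}$) of the space of symmetric functions of degree $n$, called the star basis. An acyclic orientation of $G$ is an assignment of directions to the edges so that there are no directed cycles. A vertex $v$ is a sink of an orientation if all edges incident to $v$ are directed toward $v$ (so an isolated vertex is a sink). *)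

theory Defs
  imports Complex_Main "HOL-Library.Multiset" "HOL-Library.FuncSet"
begin

definition simple_graph :: "'a set \<Rightarrow> 'a set set \<Rightarrow> bool" where
  "simple_graph V E \<longleftrightarrow> finite V \<and> (\<forall>e\<in>E. e \<subseteq> V \<and> card e = 2)"

text \<open>Colourings are extensional functions on \<open>V\<close>, so each colouring of \<open>V\<close> is counted once.\<close>

definition proper_colourings :: "'a set \<Rightarrow> 'a set set \<Rightarrow> ('a \<Rightarrow> nat) set" where
  "proper_colourings V E =
     {\<kappa> \<in> V \<rightarrow>\<^sub>E {1..}. \<forall>u w. {u, w} \<in> E \<longrightarrow> \<kappa> u \<noteq> \<kappa> w}"

text \<open>
  A formal power series over \<open>\<rat>\<close> in the commuting variables \<open>x\<^sub>1, x\<^sub>2, \<dots>\<close> is given by its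
  coefficients. A monomial is the multiset of the indices of its variables; for instance
  \<open>{#1, 1, 3#}\<close> stands for the monomial \<open>x\<^sub>1 x\<^sub>1 x\<^sub>3\<close>.
\<close>

type_synonym series = "nat multiset \<Rightarrow> rat"

text \<open>
  The monomial \<open>\<Prod>v\<in>V. x\<^bsub>\<kappa> v\<^esub>\<close> is \<open>image_mset \<kappa> (mset_set V)\<close>. The coefficient of a monomial \<open>m\<close>
  in the formal sum of these over all proper \<open>\<kappa>\<close> is the number of proper \<open>\<kappa>\<close> whose monomial
  is \<open>m\<close>; for finite \<open>V\<close> there are only finitely many of them.
\<close>

definition chromatic_sym :: "'a set \<Rightarrow> 'a set set \<Rightarrow> series" where
  "chromatic_sym V E =
     (\<lambda>m. of_nat (card {\<kappa> \<in> proper_colourings V E. image_mset \<kappa> (mset_set V) = m}))"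

definition partitions :: "nat \<Rightarrow> nat list set" where
  "partitions n = {p. sorted_wrt (\<ge>) p \<and> (\<forall>k\<in>set p. 0 < k) \<and> sum_list p = n}"

lemma finite_partitions: "finite (partitions n)"
proof (rule finite_subset)
  show "partitions n \<subseteq> {p. set p \<subseteq> {..n} \<and> length p \<le> n}"
  proof
    fix p assume p: "p \<in> partitions n"
    have "length q \<le> sum_list q" if "\<forall>k\<in>set q. 0 < k" for q :: "nat list"
      using that by (induction q) auto
    with p show "p \<in> {p. set p \<subseteq> {..n} \<and> length p \<le> n}"
      by (auto simp: partitions_def intro: member_le_sum_list)
  qed
qed (simp add: finite_lists_length_le)

text \<open>The star on \<open>k\<close> vertices has vertex set \<open>{..<k}\<close> and centre \<open>0\<close>.\<close>

definition star_edges :: "nat \<Rightarrow> nat set set" where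
  "star_edges k = {{0, j} | j. 0 < j \<and> j < k}"

text \<open>In the disjoint union of stars, \<open>(i, j)\<close> is the vertex \<open>j\<close> of the \<open>i\<close>-th star.\<close>

definition star_forest_vertices :: "nat list \<Rightarrow> (nat \<times> nat) set" where
  "star_forest_vertices p = (SIGMA i:{..<length p}. {..<p ! i})"

definition star_forest_edges :: "nat list \<Rightarrow> (nat \<times> nat) set set" where
  "star_forest_edges p = (\<Union>i<length p. (\<lambda>e. Pair i ` e) ` star_edges (p ! i))"

lemma simple_graph_star_forest:
  "simple_graph (star_forest_vertices p) (star_forest_edges p)"
  by (auto simp: simple_graph_def star_forest_vertices_def star_forest_edges_def star_edges_def)

definition star_sym :: "nat list \<Rightarrow> series" where
  "star_sym p = chromatic_sym (star_forest_vertices p) (star_forest_edges p)"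

text \<open>
  An orientation is the set of its arcs; \<open>(u, w)\<close> is the edge \<open>{u, w}\<close> directed towards \<open>w\<close>.
\<close>

definition orientations :: "'a set set \<Rightarrow> ('a \<times> 'a) set set" where
  "orientations E =
     {A. (\<forall>u w. (u, w) \<in> A \<longrightarrow> {u, w} \<in> E) \<and>
         (\<forall>u w. {u, w} \<in> E \<longrightarrow> ((u, w) \<in> A) \<noteq> ((w, u) \<in> A))}"

definition sinks :: "'a set \<Rightarrow> 'a set set \<Rightarrow> ('a \<times> 'a) set \<Rightarrow> 'a set" where
  "sinks V E A = {w \<in> V. \<forall>u. {u, w} \<in> E \<longrightarrow> (u, w) \<in> A}"

end

theory Submission
  imports Defs "HOL-Combinatorics.Transposition"
begin

text \<open>
  Evaluating a symmetric function of degree \<open>n\<close> at \<open>x\<^sub>1 = \<dots> = x\<^sub>q = 1\<close>, \<open>x\<^sub>i = 0\<close> for \<open>i > q\<close>, gives a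
  polynomial in \<open>q\<close>; for \<open>X\<^sub>G\<close> it is the chromatic polynomial. The coefficient of \<open>q\<close> in this polynomial
  is a linear functional on symmetric functions, called \<open>linear_coeff\<close> below. By a theorem of Greene
  and Zaslavsky it sends \<open>X\<^sub>G\<close> to \<open>(-1)\<^bsup>n-1\<^esup>\<close> times the number \<open>N(G, v)\<close> of acyclic orientations of \<open>G\<close>
  whose unique sink is \<open>v\<close> (\<open>linear_coeff_chromatic_sym\<close>). The theorem follows by applying the
  functional to both sides of the star expansion. A star forest with at least two stars has a sink in
  every star, so \<open>N = 0\<close>; for the single star, with \<open>v\<close> its centre, every edge must point to the centre,
  so \<open>N = 1\<close>. Hence only the term \<open>c\<^sub>n\<close> survives (\<open>linear_coeff_star_sym\<close>).

  The theorem of Greene and Zaslavsky is usually proved by deletion and contraction. The proof below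
  peels off colour classes instead. The number of colourings with \<open>q\<close> colours is
  \<open>\<Sum>\<^sub>k s\<^sub>k (q choose k)\<close>, where \<open>s\<^sub>k\<close> counts the proper colourings onto \<open>{1..k}\<close>, and
  \<open>q choose k\<close> has linear coefficient \<open>(-1)\<^bsup>k-1\<^esup>/k\<close>. Permuting colours shows that \<open>s\<^sub>k/k\<close> counts the
  surjective colourings in which \<open>v\<close> has colour \<open>1\<close> (\<open>card_surj_colourings_rooted\<close>). The colour
  class \<open>T\<close> of \<open>1\<close> is a stable set, and the remaining classes form a surjective colouring of \<open>G - T\<close>.
  On the side of orientations, the acyclic orientations of \<open>G - T\<close> correspond to those of \<open>G\<close> in which
  all vertices of \<open>T\<close> are sinks (\<open>card_acyclic_orientations_sinks\<close>). So once
  \<open>\<Sum>\<^sub>k (-1)\<^sup>k s\<^sub>k = (-1)\<^bsup>|U|\<^esup> a(U)\<close>, with \<open>a\<close> the number of acyclic orientations, is known for the smaller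
  graphs (\<open>sum_signed_surj_colourings\<close>), the sum over \<open>T\<close> becomes, for each acyclic orientation,
  a signed sum over the sets \<open>T\<close> of sinks with \<open>v \<in> T\<close>. That sum vanishes unless \<open>v\<close> is the only sink.
  The auxiliary identity is proved by the same argument, with \<open>T\<close> ranging over all nonempty sets of
  sinks.
\<close>

section \<open>Acyclic orientations with prescribed sinks\<close>

abbreviation induced :: "'a set set \<Rightarrow> 'a set \<Rightarrow> 'a set set" where
  "induced E U \<equiv> E \<inter> Pow U"

definition stable_set :: "'a set set \<Rightarrow> 'a set \<Rightarrow> bool" where
  "stable_set E T \<longleftrightarrow> (\<forall>u\<in>T. \<forall>w\<in>T. {u, w} \<notin> E)"

definition acyclic_orientations :: "'a set set \<Rightarrow> ('a \<times> 'a) set set" where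
  "acyclic_orientations E = {A \<in> orientations E. acyclic A}"

lemma acyclic_orientations_edge:
  assumes "A \<in> acyclic_orientations (induced E U)" "(u, w) \<in> A"
  shows "{u, w} \<in> E" "u \<in> U" "w \<in> U"
  using assms unfolding acyclic_orientations_def orientations_def by blast+

lemma acyclic_orientations_one_way:
  assumes "A \<in> acyclic_orientations (induced E U)" "{u, w} \<in> E" "u \<in> U" "w \<in> U"
  shows "(u, w) \<in> A \<longleftrightarrow> (w, u) \<notin> A"
proof -
  have "{u, w} \<in> induced E U"
    using assms(2-4) by simp
  then show ?thesis
    using assms(1) unfolding acyclic_orientations_def orientations_def by blast
qed

lemma acyclic_orientations_subset:
  "A \<in> acyclic_orientations (induced E U) \<Longrightarrow> A \<subseteq> U \<times> U"
  using acyclic_orientations_edge[of A E U] by fast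

lemma finite_acyclic_orientations:
  assumes "finite U"
  shows "finite (acyclic_orientations (induced E U))"
  by (rule finite_subset[of _ "Pow (U \<times> U)"])
     (use assms acyclic_orientations_subset[of _ E U] in auto)

lemma stable_sinks:
  assumes "A \<in> acyclic_orientations (induced E U)" "T \<subseteq> sinks U (induced E U) A"
  shows "stable_set E T"
  unfolding stable_set_def
proof (intro ballI notI)
  fix u w assume uw: "u \<in> T" "w \<in> T" "{u, w} \<in> E"
  have U: "u \<in> U" "w \<in> U"
    using assms(2) uw by (auto simp: sinks_def)
  then have "{u, w} \<in> induced E U" "{w, u} \<in> induced E U"
    using uw(3) by (simp_all add: insert_commute)
  then have "(u, w) \<in> A" "(w, u) \<in> A"
    using assms(2) uw unfolding sinks_def by blast+
  then show False
    using acyclic_orientations_one_way[OF assms(1) uw(3) U] by simp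
qed

text \<open>
  Following arcs in a finite acyclic orientation cannot go on for ever, so it ends in a sink.
\<close>

lemma sinks_nonempty:
  assumes "finite U" "U \<noteq> {}" "A \<in> acyclic_orientations (induced E U)"
  shows "sinks U (induced E U) A \<noteq> {}"
proof -
  have sub: "A \<subseteq> U \<times> U"
    using assms(3) by (rule acyclic_orientations_subset)
  then have "finite A"
    using assms(1) by (meson finite_SigmaI finite_subset)
  then have "wf (A\<inverse>)"
    using assms(3) by (intro finite_acyclic_wf_converse) (auto simp: acyclic_orientations_def)
  moreover obtain x where "x \<in> U"
    using assms(2) by blast
  ultimately obtain z where z: "z \<in> U" "\<And>y. (y, z) \<in> A\<inverse> \<Longrightarrow> y \<notin> U"
    by (rule wfE_min) (rule that)
  have "(u, z) \<in> A" if "{u, z} \<in> induced E U" for u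
  proof -
    have "(u, z) \<in> A \<or> (z, u) \<in> A"
      using acyclic_orientations_one_way[OF assms(3), of u z] that by auto
    then show ?thesis
      using z(2)[of u] that by auto
  qed
  then have "z \<in> sinks U (induced E U) A"
    using z(1) by (auto simp: sinks_def)
  then show ?thesis by blast
qed

text \<open>
  A cycle through an arc of \<open>C\<close> would have to leave \<open>T\<close> again.
\<close>

lemma acyclic_Un_into:
  assumes "acyclic B" and into: "\<And>x y. (x, y) \<in> C \<Longrightarrow> y \<in> T"
    and no_exit: "\<And>x y. x \<in> T \<Longrightarrow> (x, y) \<notin> B \<union> C"
  shows "acyclic (B \<union> C)"
proof (rule acyclicI, intro allI notI)
  fix x assume cyc: "(x, x) \<in> (B \<union> C)\<^sup>+"
  have step: "(x, y) \<in> B\<^sup>+ \<or> y \<in> T" if "(x, y) \<in> (B \<union> C)\<^sup>+" for y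
    using that
  proof induction
    case (base y)
    then show ?case using into by auto
  next
    case (step y z)
    then show ?case using into no_exit by (auto intro: trancl_into_trancl)
  qed
  obtain y where "(x, y) \<in> B \<union> C"
    using cyc by (meson tranclD)
  then have "x \<notin> T"
    using no_exit by blast
  then have "(x, x) \<in> B\<^sup>+"
    using step[OF cyc] by blast
  then show False
    using assms(1) by (simp add: acyclic_def)
qed

text \<open>
  Prescribing that the vertices of \<open>T\<close> are sinks fixes the direction of every edge that meets \<open>T\<close>, without
  conflict because \<open>T\<close> is stable. The remaining edges can be oriented by any acyclic orientation of
  the graph on \<open>U - T\<close>, since no cycle can pass through a sink.
\<close>

lemma card_acyclic_orientations_sinks:
  assumes T: "T \<subseteq> U" "stable_set E T"
  shows "card {A \<in> acyclic_orientations (induced E U). T \<subseteq> sinks U (induced E U) A} =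
         card (acyclic_orientations (induced E (U - T)))"
proof -
  define C where "C = {(u, w). u \<in> U \<and> w \<in> T \<and> {u, w} \<in> E}"
  let ?W = "(U - T) \<times> (U - T)"
  have "bij_betw (\<lambda>A. A \<inter> ?W)
      {A \<in> acyclic_orientations (induced E U). T \<subseteq> sinks U (induced E U) A}
      (acyclic_orientations (induced E (U - T)))"
  proof (rule bij_betw_byWitness[where f' = "\<lambda>B. B \<union> C"])
    \<comment> \<open>Every arc that meets \<open>T\<close> has its head, and only its head, in \<open>T\<close>, so \<open>C\<close> restores what was cut off.\<close>
    show "\<forall>A\<in>{A \<in> acyclic_orientations (induced E U). T \<subseteq> sinks U (induced E U) A}.
            A \<inter> ?W \<union> C = A"
    proof
      fix A assume "A \<in> {A \<in> acyclic_orientations (induced E U). T \<subseteq> sinks U (induced E U) A}"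
      then have A: "A \<in> acyclic_orientations (induced E U)" and TA: "T \<subseteq> sinks U (induced E U) A"
        by auto
      have into: "(u, w) \<in> A" if "w \<in> T" "u \<in> U" "{u, w} \<in> E" for u w
        using that TA T(1) by (auto simp: sinks_def)
      have edge: "{u, w} \<in> E \<and> u \<in> U \<and> w \<in> U \<and> (w, u) \<notin> A" if "(u, w) \<in> A" for u w
        using acyclic_orientations_edge[OF A that] acyclic_orientations_one_way[OF A, of u w] that
        by simp
      have out: "u \<notin> T" if "(u, w) \<in> A" for u w
      proof
        assume "u \<in> T"
        then have "(w, u) \<in> A"
          using into[of u w] edge[OF that] by (simp add: insert_commute)
        then show False
          using edge[OF that] by blast
      qed
      show "A \<inter> ?W \<union> C = A"
        using into edge out unfolding C_def by blast
    qed
    show "\<forall>B\<in>acyclic_orientations (induced E (U - T)). (B \<union> C) \<inter> ?W = B"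
      using acyclic_orientations_subset[of _ E "U - T"] by (fastforce simp: C_def)
    show "(\<lambda>A. A \<inter> ?W) ` {A \<in> acyclic_orientations (induced E U). T \<subseteq> sinks U (induced E U) A}
            \<subseteq> acyclic_orientations (induced E (U - T))"
    proof (rule image_subsetI)
      fix A assume "A \<in> {A \<in> acyclic_orientations (induced E U). T \<subseteq> sinks U (induced E U) A}"
      then have A: "A \<in> acyclic_orientations (induced E U)"
        by simp
      have "acyclic (A \<inter> ?W)"
        by (rule acyclic_subset[of A]) (use A in \<open>auto simp: acyclic_orientations_def\<close>)
      moreover have "A \<inter> ?W \<in> orientations (induced E (U - T))"
        unfolding orientations_def mem_Collect_eq
      proof (intro conjI allI impI)
        fix u w assume "(u, w) \<in> A \<inter> ?W"
        then show "{u, w} \<in> induced E (U - T)"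
          using acyclic_orientations_edge[OF A, of u w] by simp
      next
        fix u w assume "{u, w} \<in> induced E (U - T)"
        then have "{u, w} \<in> E" "u \<in> U - T" "w \<in> U - T"
          by simp_all
        then show "((u, w) \<in> A \<inter> ?W) \<noteq> ((w, u) \<in> A \<inter> ?W)"
          using acyclic_orientations_one_way[OF A, of u w] by simp
      qed
      ultimately show "A \<inter> ?W \<in> acyclic_orientations (induced E (U - T))"
        by (simp add: acyclic_orientations_def)
    qed
    show "(\<lambda>B. B \<union> C) ` acyclic_orientations (induced E (U - T)) \<subseteq>
          {A \<in> acyclic_orientations (induced E U). T \<subseteq> sinks U (induced E U) A}"
    proof (rule image_subsetI)
      fix B assume B: "B \<in> acyclic_orientations (induced E (U - T))"
      have sub: "B \<subseteq> ?W"
        using B by (rule acyclic_orientations_subset)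
      have edgeB: "{u, w} \<in> E" if "(u, w) \<in> B" for u w
        using acyclic_orientations_edge[OF B that] by simp
      have oneB: "((u, w) \<in> B) \<noteq> ((w, u) \<in> B)" if "{u, w} \<in> E" "u \<in> U - T" "w \<in> U - T" for u w
        using acyclic_orientations_one_way[OF B that] by simp
      have "acyclic (B \<union> C)"
      proof (rule acyclic_Un_into)
        show "acyclic B"
          using B by (simp add: acyclic_orientations_def)
        show "(x, y) \<notin> B \<union> C" if "x \<in> T" for x y
          using that sub T(2) by (auto simp: C_def stable_set_def)
      qed (auto simp: C_def)
      moreover have "B \<union> C \<in> orientations (induced E U)"
        unfolding orientations_def mem_Collect_eq
      proof (intro conjI allI impI)
        fix u w assume "(u, w) \<in> B \<union> C"
        then show "{u, w} \<in> induced E U"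
          using edgeB sub T(1) unfolding C_def by auto
      next
        fix u w assume "{u, w} \<in> induced E U"
        then have uw: "{u, w} \<in> E" "{w, u} \<in> E" "u \<in> U" "w \<in> U"
          by (auto simp: insert_commute)
        show "((u, w) \<in> B \<union> C) \<noteq> ((w, u) \<in> B \<union> C)"
        proof (cases "u \<in> T \<or> w \<in> T")
          case True
          then show ?thesis
            using uw sub T(2) unfolding C_def stable_set_def by blast
        next
          case False
          then show ?thesis
            using uw oneB[of u w] unfolding C_def by blast
        qed
      qed
      moreover have "T \<subseteq> sinks U (induced E U) (B \<union> C)"
        using T(1) by (auto simp: sinks_def C_def)
      ultimately show "B \<union> C \<in>
          {A \<in> acyclic_orientations (induced E U). T \<subseteq> sinks U (induced E U) A}"
        by (simp add: acyclic_orientations_def)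
    qed
  qed
  then show ?thesis
    by (rule bij_betw_same_card)
qed

text \<open>
  Double counting of the pairs of an acyclic orientation and a set \<open>T\<close> of its sinks. The condition that
  \<open>T\<close> is stable disappears on the right because a set of sinks is always stable.
\<close>

lemma sum_signed_acyclic_orientations:
  fixes Q :: "'a set \<Rightarrow> bool"
  assumes "finite U"
  shows "(\<Sum>T\<in>{T. T \<subseteq> U \<and> stable_set E T \<and> Q T}.
            (-1) ^ card T * of_nat (card (acyclic_orientations (induced E (U - T))))) =
         (\<Sum>A\<in>acyclic_orientations (induced E U).
            \<Sum>T\<in>{T. T \<subseteq> sinks U (induced E U) A \<and> Q T}. (-1) ^ card T :: rat)"
    (is "sum ?f ?Ts = sum ?g ?As")
proof -
  have fin: "finite ?Ts" "finite ?As"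
    using assms finite_acyclic_orientations by auto
  have "sum ?f ?Ts =
        (\<Sum>T\<in>?Ts. \<Sum>A\<in>{A \<in> ?As. T \<subseteq> sinks U (induced E U) A}. (-1) ^ card T)"
    by (intro sum.cong refl)
       (simp add: card_acyclic_orientations_sinks[symmetric] mult.commute)
  also have "\<dots> = (\<Sum>A\<in>?As. \<Sum>T\<in>{T \<in> ?Ts. T \<subseteq> sinks U (induced E U) A}. (-1) ^ card T)"
    by (rule sum.swap_restrict[OF fin])
  also have "\<dots> = sum ?g ?As"
  proof (intro sum.cong refl)
    fix A assume "A \<in> ?As"
    then show "{T \<in> ?Ts. T \<subseteq> sinks U (induced E U) A} =
               {T. T \<subseteq> sinks U (induced E U) A \<and> Q T}"
      using stable_sinks[of A E U] by (auto simp: sinks_def)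
  qed
  finally show ?thesis .
qed

lemma sum_signed_subsets:
  assumes "finite S"
  shows "(\<Sum>T\<in>Pow S. (-1) ^ card T :: rat) = (if S = {} then 1 else 0)"
proof -
  have "(\<Sum>T\<in>Pow S. (-1) ^ card T :: rat) = (\<Prod>x\<in>S. 1 - 1)"
    using prod_diff_conv_sum[OF assms, of "\<lambda>_. 1 :: rat" "\<lambda>_. 1"] by (simp only: prod.neutral_const mult_1_right)
  also have "\<dots> = (if S = {} then 1 else 0)"
    using assms by (simp add: card_gt_0_iff)
  finally show ?thesis .
qed

lemma sum_signed_nonempty_subsets:
  assumes "finite S" "S \<noteq> {}"
  shows "(\<Sum>T\<in>{T. T \<subseteq> S \<and> T \<noteq> {}}. (-1) ^ card T :: rat) = - 1"
proof -
  have "{T. T \<subseteq> S \<and> T \<noteq> {}} = Pow S - {{}}" by auto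
  then show ?thesis
    using assms sum_signed_subsets[of S] by (simp add: sum_diff1)
qed

lemma sum_signed_subsets_containing:
  assumes "finite S"
  shows "(\<Sum>T\<in>{T. T \<subseteq> S \<and> x \<in> T}. (-1) ^ card T :: rat) = (if S = {x} then - 1 else 0)"
proof (cases "x \<in> S")
  case True
  have "{T. T \<subseteq> S \<and> x \<in> T} = insert x ` Pow (S - {x})"
  proof (intro equalityI subsetI)
    fix T assume "T \<in> {T. T \<subseteq> S \<and> x \<in> T}"
    then show "T \<in> insert x ` Pow (S - {x})"
      by (intro image_eqI[of _ _ "T - {x}"]) auto
  qed (use True in auto)
  moreover have "inj_on (insert x) (Pow (S - {x}))"
    by (auto simp: inj_on_def)
  ultimately have "(\<Sum>T\<in>{T. T \<subseteq> S \<and> x \<in> T}. (-1) ^ card T :: rat) =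
      (\<Sum>T\<in>Pow (S - {x}). (-1) ^ card (insert x T))"
    by (simp add: sum.reindex)
  also have "\<dots> = (\<Sum>T\<in>Pow (S - {x}). - ((-1) ^ card T))"
  proof (intro sum.cong refl)
    fix T assume "T \<in> Pow (S - {x})"
    then have "finite T" "x \<notin> T"
      using assms finite_subset by auto
    then show "(-1) ^ card (insert x T) = - ((-1) ^ card T :: rat)"
      by simp
  qed
  also have "\<dots> = - (\<Sum>T\<in>Pow (S - {x}). (-1) ^ card T)"
    by (rule sum_negf)
  also have "\<dots> = (if S - {x} = {} then - 1 else 0)"
    using assms by (subst sum_signed_subsets) auto
  also have "\<dots> = (if S = {x} then - 1 else 0)"
    using True by auto
  finally show ?thesis .
next
  case False
  then have "{T. T \<subseteq> S \<and> x \<in> T} = {}" by auto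
  then show ?thesis
    using False by (auto split: if_splits simp del: Collect_empty_eq)
qed

section \<open>Surjective colourings\<close>

definition surj_colourings :: "'a set \<Rightarrow> 'a set set \<Rightarrow> nat \<Rightarrow> ('a \<Rightarrow> nat) set" where
  "surj_colourings U E k = {\<kappa> \<in> proper_colourings U E. \<kappa> ` U = {1..k}}"

lemma surj_colourings_induced_iff:
  "\<kappa> \<in> surj_colourings U (induced E U) k \<longleftrightarrow>
     \<kappa> \<in> extensional U \<and> \<kappa> ` U = {1..k} \<and>
     (\<forall>u\<in>U. \<forall>w\<in>U. {u, w} \<in> E \<longrightarrow> \<kappa> u \<noteq> \<kappa> w)"
proof -
  have "\<kappa> ` U = {1..k} \<Longrightarrow> \<kappa> \<in> U \<rightarrow> {1..}" by fastforce
  then show ?thesis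
    unfolding surj_colourings_def proper_colourings_def PiE_def by auto
qed

lemma finite_surj_colourings:
  assumes "finite U"
  shows "finite (surj_colourings U E k)"
proof (rule finite_subset)
  show "surj_colourings U E k \<subseteq> U \<rightarrow>\<^sub>E {1..k}"
    by (auto simp: surj_colourings_def proper_colourings_def PiE_def)
  show "finite (U \<rightarrow>\<^sub>E {1..k})"
    using assms by (intro finite_PiE) auto
qed

lemma surj_colourings_0: "U \<noteq> {} \<Longrightarrow> surj_colourings U E 0 = {}"
  by (auto simp: surj_colourings_def)

lemma surj_colourings_empty: "k > 0 \<Longrightarrow> surj_colourings {} E k = {}"
  by (auto simp: surj_colourings_def)

text \<open>
  Deleting the class of colour \<open>1\<close> and lowering all other colours by one is a bijection.
\<close>

lemma card_surj_colourings_first_class: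
  assumes "T \<subseteq> U" "T \<noteq> {}" "stable_set E T"
  shows "card {\<kappa> \<in> surj_colourings U (induced E U) (Suc k). {u \<in> U. \<kappa> u = 1} = T} =
         card (surj_colourings (U - T) (induced E (U - T)) k)"
proof -
  let ?S = "{\<kappa> \<in> surj_colourings U (induced E U) (Suc k). {u \<in> U. \<kappa> u = 1} = T}"
  let ?R = "surj_colourings (U - T) (induced E (U - T)) k"
  define f :: "('a \<Rightarrow> nat) \<Rightarrow> 'a \<Rightarrow> nat" where "f \<kappa> = (\<lambda>u\<in>U - T. \<kappa> u - 1)" for \<kappa>
  define g :: "('a \<Rightarrow> nat) \<Rightarrow> 'a \<Rightarrow> nat" where
    "g \<kappa> = (\<lambda>u\<in>U. if u \<in> T then 1 else Suc (\<kappa> u))" for \<kappa>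
  have low: "\<kappa> u = 1 \<longleftrightarrow> u \<in> T" "1 \<le> \<kappa> u" "\<kappa> u \<le> Suc k" if "\<kappa> \<in> ?S" "u \<in> U" for \<kappa> u
  proof -
    have "\<kappa> ` U = {1..Suc k}"
      using that by (simp add: surj_colourings_induced_iff)
    then show "1 \<le> \<kappa> u" "\<kappa> u \<le> Suc k"
      using that by (metis atLeastAtMost_iff imageI)+
    show "\<kappa> u = 1 \<longleftrightarrow> u \<in> T" using that by blast
  qed
  have "bij_betw f ?S ?R"
  proof (rule bij_betw_byWitness[where f' = g])
    show "\<forall>\<kappa>\<in>?S. g (f \<kappa>) = \<kappa>"
    proof (intro ballI ext)
      fix \<kappa> u assume k: "\<kappa> \<in> ?S"
      then have "\<kappa> \<in> extensional U" by (simp add: surj_colourings_induced_iff)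
      then show "g (f \<kappa>) u = \<kappa> u"
        using low[OF k, of u] by (auto simp: f_def g_def extensional_def)
    qed
    show "\<forall>\<kappa>\<in>?R. f (g \<kappa>) = \<kappa>"
      by (auto simp: f_def g_def extensional_def surj_colourings_induced_iff fun_eq_iff)
    show "f ` ?S \<subseteq> ?R"
    proof (rule image_subsetI)
      fix \<kappa> assume k: "\<kappa> \<in> ?S"
      have im: "\<kappa> ` U = {1..Suc k}" and
        pr: "\<And>u w. u \<in> U \<Longrightarrow> w \<in> U \<Longrightarrow> {u, w} \<in> E \<Longrightarrow> \<kappa> u \<noteq> \<kappa> w"
        using k by (auto simp: surj_colourings_induced_iff)
      have "f \<kappa> ` (U - T) = {1..k}"
      proof (intro equalityI subsetI)
        fix i assume "i \<in> f \<kappa> ` (U - T)"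
        then obtain u where u: "u \<in> U" "u \<notin> T" "i = \<kappa> u - 1" by (auto simp: f_def)
        then show "i \<in> {1..k}" using low[OF k, of u] by auto
      next
        fix i assume i: "i \<in> {1..k}"
        then have "Suc i \<in> \<kappa> ` U" by (simp add: im)
        then obtain u where u: "u \<in> U" "\<kappa> u = Suc i" by auto
        then have "u \<notin> T" using low(1)[OF k, of u] i by auto
        then show "i \<in> f \<kappa> ` (U - T)" using u by (intro image_eqI[of _ _ u]) (auto simp: f_def)
      qed
      moreover have "f \<kappa> u \<noteq> f \<kappa> w" if "u \<in> U - T" "w \<in> U - T" "{u, w} \<in> E" for u w
        using that pr[of u w] low(2)[OF k, of u] low(2)[OF k, of w] by (auto simp: f_def)
      ultimately show "f \<kappa> \<in> ?R"
        by (auto simp: surj_colourings_induced_iff f_def)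
    qed
    show "g ` ?R \<subseteq> ?S"
    proof (rule image_subsetI)
      fix \<kappa> assume k: "\<kappa> \<in> ?R"
      have im: "\<kappa> ` (U - T) = {1..k}" and
        pr: "\<And>u w. u \<in> U - T \<Longrightarrow> w \<in> U - T \<Longrightarrow> {u, w} \<in> E \<Longrightarrow> \<kappa> u \<noteq> \<kappa> w"
        using k by (auto simp: surj_colourings_induced_iff)
      have pos: "\<kappa> u \<ge> 1" if "u \<in> U" "u \<notin> T" for u
        using im that by (metis DiffI atLeastAtMost_iff imageI)
      have "g \<kappa> ` U = g \<kappa> ` T \<union> g \<kappa> ` (U - T)"
        using assms(1) by auto
      also have "g \<kappa> ` T = {1}"
        using assms(1,2) by (auto simp: g_def)
      also have "g \<kappa> ` (U - T) = Suc ` \<kappa> ` (U - T)"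
        unfolding image_image by (rule image_cong) (auto simp: g_def)
      also have "{1} \<union> Suc ` \<kappa> ` (U - T) = {1..Suc k}"
        unfolding im by (auto simp: image_Suc_atLeastAtMost)
      finally have "g \<kappa> ` U = {1..Suc k}" .
      moreover have "g \<kappa> u \<noteq> g \<kappa> w" if "u \<in> U" "w \<in> U" "{u, w} \<in> E" for u w
        using that pr[of u w] pos[of u] pos[of w] assms(3) by (auto simp: g_def stable_set_def)
      moreover have "g \<kappa> u = 1 \<longleftrightarrow> u \<in> T" if "u \<in> U" for u
        using pos[of u] that by (auto simp: g_def)
      then have "{u \<in> U. g \<kappa> u = 1} = T"
        using assms(1) by blast
      ultimately show "g \<kappa> \<in> ?S"
        by (auto simp: surj_colourings_induced_iff g_def)
    qed
  qed
  then show ?thesis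
    by (rule bij_betw_same_card)
qed

lemma card_surj_colourings_Suc:
  assumes "finite U" and Q: "\<And>T. Q T \<Longrightarrow> T \<noteq> {}"
  shows "card {\<kappa> \<in> surj_colourings U (induced E U) (Suc k). Q {u \<in> U. \<kappa> u = 1}} =
         (\<Sum>T\<in>{T. T \<subseteq> U \<and> stable_set E T \<and> Q T}.
            card (surj_colourings (U - T) (induced E (U - T)) k))"
proof -
  let ?S = "{\<kappa> \<in> surj_colourings U (induced E U) (Suc k). Q {u \<in> U. \<kappa> u = 1}}"
  let ?Ts = "{T. T \<subseteq> U \<and> stable_set E T \<and> Q T}"
  have "finite ?S"
    by (rule finite_subset[OF _ finite_surj_colourings[OF assms(1)]]) blast
  moreover have "finite ?Ts"
    using assms(1) by simp
  ultimately have fin: "finite ?S" "finite ?Ts" .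
  have "(\<lambda>\<kappa>. {u \<in> U. \<kappa> u = 1}) ` ?S \<subseteq> ?Ts"
  proof (rule image_subsetI)
    fix \<kappa> assume k: "\<kappa> \<in> ?S"
    then have "\<kappa> u \<noteq> \<kappa> w" if "u \<in> U" "w \<in> U" "{u, w} \<in> E" for u w
      using that unfolding mem_Collect_eq surj_colourings_induced_iff by blast
    then have "stable_set E {u \<in> U. \<kappa> u = 1}"
      unfolding stable_set_def by fastforce
    then show "{u \<in> U. \<kappa> u = 1} \<in> ?Ts"
      using k by blast
  qed
  then have "card ?S = (\<Sum>T\<in>?Ts. card {\<kappa> \<in> ?S. {u \<in> U. \<kappa> u = 1} = T})"
    using sum.group[OF fin, where h = "\<lambda>_. 1 :: nat"] by simp
  also have "\<dots> = (\<Sum>T\<in>?Ts. card (surj_colourings (U - T) (induced E (U - T)) k))"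
  proof (intro sum.cong refl)
    fix T assume T: "T \<in> ?Ts"
    then have "{\<kappa> \<in> ?S. {u \<in> U. \<kappa> u = 1} = T} =
        {\<kappa> \<in> surj_colourings U (induced E U) (Suc k). {u \<in> U. \<kappa> u = 1} = T}"
      by auto
    then show "card {\<kappa> \<in> ?S. {u \<in> U. \<kappa> u = 1} = T} =
        card (surj_colourings (U - T) (induced E (U - T)) k)"
      using T Q card_surj_colourings_first_class[of T U E k] by auto
  qed
  finally show ?thesis .
qed

text \<open>
  The step common to the unrooted and the rooted count below: peel off the first colour class \<open>T\<close>, apply
  the known identity for \<open>U - T\<close>, and turn the sum over \<open>T\<close> into one over sets of sinks. The predicate \<open>Q\<close>
  is \<open>T \<noteq> {}\<close> in the unrooted and \<open>v \<in> T\<close> in the rooted case.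
\<close>

lemma peel_first_class:
  assumes U: "finite U" and Q: "\<And>T. Q T \<Longrightarrow> T \<noteq> {}"
    and smaller: "\<And>T. T \<subseteq> U \<Longrightarrow> T \<noteq> {} \<Longrightarrow>
      (\<Sum>k\<le>N. (-1) ^ k * of_nat (card (surj_colourings (U - T) (induced E (U - T)) k))) =
      (-1) ^ card (U - T) * (of_nat (card (acyclic_orientations (induced E (U - T)))) :: rat)"
  shows "(\<Sum>k\<le>N. (-1) ^ k *
            of_nat (card {\<kappa> \<in> surj_colourings U (induced E U) (Suc k). Q {u \<in> U. \<kappa> u = 1}})) =
         (-1) ^ card U * (\<Sum>A\<in>acyclic_orientations (induced E U).
            \<Sum>T\<in>{T. T \<subseteq> sinks U (induced E U) A \<and> Q T}. (-1) ^ card T :: rat)"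
proof -
  let ?Ts = "{T. T \<subseteq> U \<and> stable_set E T \<and> Q T}"
  let ?s = "\<lambda>T k. card (surj_colourings (U - T) (induced E (U - T)) k)"
  let ?a = "\<lambda>T. of_nat (card (acyclic_orientations (induced E (U - T)))) :: rat"
  have "(\<Sum>k\<le>N. (-1) ^ k *
            of_nat (card {\<kappa> \<in> surj_colourings U (induced E U) (Suc k). Q {u \<in> U. \<kappa> u = 1}})) =
        (\<Sum>k\<le>N. \<Sum>T\<in>?Ts. (-1) ^ k * (of_nat (?s T k) :: rat))"
    by (simp add: card_surj_colourings_Suc[OF U Q] sum_distrib_left del: One_nat_def)
  also have "\<dots> = (\<Sum>T\<in>?Ts. \<Sum>k\<le>N. (-1) ^ k * of_nat (?s T k))"
    by (rule sum.swap)
  also have "\<dots> = (\<Sum>T\<in>?Ts. (-1) ^ card U * ((-1) ^ card T * ?a T))"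
  proof (intro sum.cong refl)
    fix T assume T: "T \<in> ?Ts"
    then have "card T \<le> card U" "card (U - T) = card U - card T"
      using U by (auto simp: card_mono card_Diff_subset finite_subset)
    then have "(-1) ^ card (U - T) = (-1 :: rat) ^ (card U + card T)"
      by (simp add: minus_one_power_iff)
    then show "(\<Sum>k\<le>N. (-1) ^ k * of_nat (?s T k)) = (-1) ^ card U * ((-1) ^ card T * ?a T)"
      using T Q smaller[of T] by (auto simp: power_add)
  qed
  also have "\<dots> = (-1) ^ card U * (\<Sum>T\<in>?Ts. (-1) ^ card T * ?a T)"
    by (simp add: sum_distrib_left)
  finally show ?thesis
    by (simp add: sum_signed_acyclic_orientations[OF U])
qed

text \<open>
  This is Stanley's theorem that the chromatic polynomial at \<open>-1\<close> is, up to sign, the number of acyclic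
  orientations, because \<open>-1 choose k\<close> is \<open>(-1)\<^sup>k\<close>. In the induction step every acyclic orientation has a
  nonempty set of sinks and therefore contributes \<open>-1\<close>. The bound \<open>N\<close> is left free
  so that one bound serves all the subgraphs \<open>U - T\<close> of different sizes.
\<close>

lemma sum_signed_surj_colourings:
  assumes "finite U" "card U \<le> N"
  shows "(\<Sum>k\<le>N. (-1) ^ k * of_nat (card (surj_colourings U (induced E U) k))) =
         (-1) ^ card U * (of_nat (card (acyclic_orientations (induced E U))) :: rat)"
  using assms
proof (induction "card U" arbitrary: U N rule: less_induct)
  case less
  show ?case
  proof (cases "U = {}")
    case True
    have "surj_colourings {} (induced E {}) 0 = {\<lambda>_. undefined}"
      unfolding set_eq_iff surj_colourings_induced_iff by (auto simp: extensional_def)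
    moreover have "acyclic_orientations (induced E {}) = {{}}"
      using acyclic_orientations_subset[of _ E "{}"]
      by (auto simp: acyclic_orientations_def orientations_def wf_acyclic)
    moreover have "(\<Sum>k\<le>N. (-1) ^ k * of_nat (card (surj_colourings {} (induced E {}) k)) :: rat) =
        (\<Sum>k\<in>{0}. (-1) ^ k * of_nat (card (surj_colourings {} (induced E {}) k)))"
      by (rule sum.mono_neutral_right) (auto simp: surj_colourings_empty)
    ultimately show ?thesis
      using True by simp
  next
    case False
    then obtain M where M: "N = Suc M"
      using less.prems by (cases N) auto
    let ?S = "\<lambda>k. surj_colourings U (induced E U) k"
    have first: "{\<kappa> \<in> ?S (Suc k). {u \<in> U. \<kappa> u = 1} \<noteq> {}} = ?S (Suc k)" for k
    proof -
      have "{u \<in> U. \<kappa> u = 1} \<noteq> {}" if "\<kappa> \<in> ?S (Suc k)" for \<kappa>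
      proof -
        have "1 \<in> \<kappa> ` U" using that by (simp add: surj_colourings_induced_iff)
        then show ?thesis by (metis (mono_tags, lifting) empty_Collect_eq imageE)
      qed
      then show ?thesis by blast
    qed
    have "(\<Sum>k\<le>N. (-1) ^ k * of_nat (card (?S k)) :: rat) =
          - (\<Sum>k\<le>M. (-1) ^ k * of_nat (card (?S (Suc k))))"
      using False by (simp add: M sum.atMost_Suc_shift surj_colourings_0 sum_negf
          del: sum.atMost_Suc)
    also have "(\<Sum>k\<le>M. (-1) ^ k * of_nat (card (?S (Suc k))) :: rat) =
          (-1) ^ card U * (\<Sum>A\<in>acyclic_orientations (induced E U).
            \<Sum>T\<in>{T. T \<subseteq> sinks U (induced E U) A \<and> T \<noteq> {}}. (-1) ^ card T)"
    proof (rule peel_first_class[where Q = "\<lambda>T. T \<noteq> {}" and U = U and E = E, unfolded first])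
      fix T assume T: "T \<subseteq> U" "T \<noteq> {}"
      then have "card (U - T) < card U"
        using less.prems by (intro psubset_card_mono) auto
      then show "(\<Sum>k\<le>M. (-1) ^ k * of_nat (card (surj_colourings (U - T) (induced E (U - T)) k))) =
          (-1) ^ card (U - T) * (of_nat (card (acyclic_orientations (induced E (U - T)))) :: rat)"
        using less.prems M by (intro less.hyps) auto
    qed (use less.prems in auto)
    also have "(\<Sum>A\<in>acyclic_orientations (induced E U).
            \<Sum>T\<in>{T. T \<subseteq> sinks U (induced E U) A \<and> T \<noteq> {}}. (-1) ^ card T :: rat) =
          (\<Sum>A\<in>acyclic_orientations (induced E U). - 1)"
    proof (intro sum.cong refl sum_signed_nonempty_subsets)
      fix A assume "A \<in> acyclic_orientations (induced E U)"
      then show "sinks U (induced E U) A \<noteq> {}"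
        using less.prems False by (intro sinks_nonempty)
      show "finite (sinks U (induced E U) A)"
        using less.prems by (simp add: sinks_def)
    qed
    finally show ?thesis by simp
  qed
qed

text \<open>
  With \<open>v\<close> in the first colour class, only the sets of sinks that contain \<open>v\<close> are summed over, and their
  signs cancel unless \<open>v\<close> is the only sink.
\<close>

lemma sum_signed_surj_colourings_rooted:
  assumes "finite V" "v \<in> V"
  shows "(\<Sum>k<card V. (-1) ^ k *
            of_nat (card {\<kappa> \<in> surj_colourings V (induced E V) (Suc k). \<kappa> v = 1})) =
         - ((-1) ^ card V) * (of_nat (card {A \<in> acyclic_orientations (induced E V).
              sinks V (induced E V) A = {v}}) :: rat)"
proof -
  have pos: "card V > 0"
    using assms card_gt_0_iff by blast
  then have idx: "{..<card V} = {..card V - 1}" by auto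
  have cls: "\<kappa> v = 1 \<longleftrightarrow> v \<in> {u \<in> V. \<kappa> u = 1}" for \<kappa> :: "'a \<Rightarrow> nat"
    using assms(2) by simp
  have fin: "finite (sinks V (induced E V) A)" for A
    using assms(1) by (simp add: sinks_def)
  have "(\<Sum>k<card V. (-1) ^ k *
            of_nat (card {\<kappa> \<in> surj_colourings V (induced E V) (Suc k). \<kappa> v = 1})) =
        (-1) ^ card V * (\<Sum>A\<in>acyclic_orientations (induced E V).
            \<Sum>T\<in>{T. T \<subseteq> sinks V (induced E V) A \<and> v \<in> T}. (-1) ^ card T :: rat)"
    unfolding idx
  proof (subst cls, rule peel_first_class)
    fix T assume T: "T \<subseteq> V" "T \<noteq> {}"
    then have "card (V - T) < card V"
      using assms by (intro psubset_card_mono) auto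
    then show "(\<Sum>k\<le>card V - 1. (-1) ^ k *
          of_nat (card (surj_colourings (V - T) (induced E (V - T)) k))) =
        (-1) ^ card (V - T) * (of_nat (card (acyclic_orientations (induced E (V - T)))) :: rat)"
      using assms by (intro sum_signed_surj_colourings) auto
  qed (use assms in auto)
  also have "\<dots> = (-1) ^ card V * (\<Sum>A\<in>acyclic_orientations (induced E V).
            if sinks V (induced E V) A = {v} then - 1 else 0)"
    by (simp add: sum_signed_subsets_containing[OF fin])
  also have "\<dots> = (-1) ^ card V * - of_nat (card {A \<in> acyclic_orientations (induced E V).
              sinks V (induced E V) A = {v}})"
    using finite_acyclic_orientations[OF assms(1), of E]
    by (simp add: sum.If_cases Int_def)
  finally show ?thesis by simp
qed

text \<open>
  Exchanging the colours \<open>1\<close> and \<open>i\<close> shows that \<open>v\<close> has each of the \<open>k\<close> colours equally often.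
\<close>

lemma card_surj_colourings_rooted:
  assumes "finite V" "v \<in> V"
  shows "card (surj_colourings V (induced E V) k) =
         k * card {\<kappa> \<in> surj_colourings V (induced E V) k. \<kappa> v = 1}"
proof -
  let ?S = "surj_colourings V (induced E V) k"
  have same: "card {\<kappa> \<in> ?S. \<kappa> v = i} = card {\<kappa> \<in> ?S. \<kappa> v = 1}" if i: "i \<in> {1..k}" for i
  proof -
    define f :: "('a \<Rightarrow> nat) \<Rightarrow> 'a \<Rightarrow> nat" where "f \<kappa> = (\<lambda>u\<in>V. transpose 1 i (\<kappa> u))" for \<kappa>
    have inS: "f \<kappa> \<in> ?S" if "\<kappa> \<in> ?S" for \<kappa>
    proof -
      have "f \<kappa> ` V = transpose 1 i ` \<kappa> ` V"
        by (auto simp: f_def image_image)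
      also have "\<kappa> ` V = {1..k}"
        using that by (simp add: surj_colourings_induced_iff)
      also have "transpose 1 i ` {1..k} = {1..k}"
        using i by (intro transpose_image_eq) auto
      finally have "f \<kappa> ` V = {1..k}" .
      moreover have "f \<kappa> u \<noteq> f \<kappa> w" if "u \<in> V" "w \<in> V" "\<kappa> u \<noteq> \<kappa> w" for u w
        using that transpose_eq_imp_eq[of 1 i "\<kappa> u" "\<kappa> w"] by (auto simp: f_def)
      moreover have "f \<kappa> \<in> extensional V"
        by (simp add: f_def)
      ultimately show ?thesis
        using that unfolding surj_colourings_induced_iff by blast
    qed
    have inv: "f (f \<kappa>) = \<kappa>" if "\<kappa> \<in> ?S" for \<kappa>
    proof -
      have "\<kappa> \<in> extensional V"
        using that by (simp add: surj_colourings_induced_iff)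
      then show ?thesis
        by (auto simp: f_def fun_eq_iff extensional_def)
    qed
    have "bij_betw f {\<kappa> \<in> ?S. \<kappa> v = i} {\<kappa> \<in> ?S. \<kappa> v = 1}"
    proof (rule bij_betw_byWitness[where f' = f])
      show "f ` {\<kappa> \<in> ?S. \<kappa> v = i} \<subseteq> {\<kappa> \<in> ?S. \<kappa> v = 1}"
        "f ` {\<kappa> \<in> ?S. \<kappa> v = 1} \<subseteq> {\<kappa> \<in> ?S. \<kappa> v = i}"
        using inS assms(2) by (auto simp: f_def)
    qed (use inv in auto)
    then show ?thesis
      by (rule bij_betw_same_card)
  qed
  have "(\<lambda>\<kappa>. \<kappa> v) ` ?S \<subseteq> {1..k}"
  proof (rule image_subsetI)
    fix \<kappa> assume "\<kappa> \<in> ?S"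
    then have "\<kappa> ` V = {1..k}"
      by (simp add: surj_colourings_induced_iff)
    then show "\<kappa> v \<in> {1..k}"
      using assms(2) by blast
  qed
  from sum.group[OF finite_surj_colourings[OF assms(1)] finite_atLeastAtMost this,
      where h = "\<lambda>_. 1 :: nat"]
  have "card ?S = (\<Sum>i\<in>{1..k}. card {\<kappa> \<in> ?S. \<kappa> v = i})"
    by simp
  also have "\<dots> = (\<Sum>i\<in>{1..k}. card {\<kappa> \<in> ?S. \<kappa> v = 1})"
    by (rule sum.cong[OF refl same])
  finally show ?thesis by simp
qed

section \<open>The linear coefficient of the chromatic polynomial\<close>

definition full_monomials :: "nat \<Rightarrow> nat \<Rightarrow> nat multiset set" where
  "full_monomials n k = {m. size m = n \<and> set_mset m = {1..k}}"

text \<open>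
  For a symmetric function \<open>f\<close> that is homogeneous of degree \<open>n\<close>, this is the coefficient of \<open>q\<close> in the
  polynomial \<open>f(1\<^sup>q)\<close>. The monomials in exactly \<open>j\<close> of the first \<open>q\<close> variables contribute
  \<open>q choose j\<close> times the sum of the coefficients of those in exactly \<open>x\<^sub>1, \<dots>, x\<^sub>j\<close>, and \<open>q choose j\<close> has
  linear coefficient \<open>(-1)\<^bsup>j-1\<^esup>/j\<close>. The index is shifted: \<open>j\<close> is \<open>Suc k\<close>.
\<close>

definition linear_coeff :: "nat \<Rightarrow> series \<Rightarrow> rat" where
  "linear_coeff n f =
     (\<Sum>k<n. (-1) ^ k / of_nat (Suc k) * (\<Sum>m\<in>full_monomials n (Suc k). f m))"

lemma finite_full_monomials: "finite (full_monomials n k)"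
proof (rule finite_subset)
  show "full_monomials n k \<subseteq> multisets_of_size {1..k} n"
    by (auto simp: full_monomials_def multisets_of_size_def)
qed (simp add: finite_multisets_of_size)

lemma linear_coeff_sum:
  "linear_coeff n (\<lambda>m. \<Sum>p\<in>P. c p * f p m) = (\<Sum>p\<in>P. c p * linear_coeff n (f p))"
proof -
  have "linear_coeff n (\<lambda>m. \<Sum>p\<in>P. c p * f p m) =
      (\<Sum>k<n. \<Sum>p\<in>P. c p * ((-1) ^ k / of_nat (Suc k) * (\<Sum>m\<in>full_monomials n (Suc k). f p m)))"
    unfolding linear_coeff_def
    by (intro sum.cong refl, subst sum.swap) (simp add: sum_distrib_left sum_divide_distrib mult_ac)
  also have "\<dots> = (\<Sum>p\<in>P. c p * linear_coeff n (f p))"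
    unfolding linear_coeff_def by (subst sum.swap) (simp only: sum_distrib_left)
  finally show ?thesis .
qed

text \<open>
  The monomial of a colouring involves exactly the variables whose indices are colours in use.
\<close>

lemma sum_chromatic_sym_full:
  assumes "finite V" "card V = n"
  shows "(\<Sum>m\<in>full_monomials n k. chromatic_sym V E m) = of_nat (card (surj_colourings V E k))"
proof -
  have full: "image_mset \<kappa> (mset_set V) \<in> full_monomials n k \<longleftrightarrow> \<kappa> ` V = {1..k}" for \<kappa>
    using assms by (simp add: full_monomials_def)
  let ?S = "surj_colourings V E k" and ?mon = "\<lambda>\<kappa>. image_mset \<kappa> (mset_set V)"
  have "chromatic_sym V E m = of_nat (card {\<kappa> \<in> ?S. ?mon \<kappa> = m})"
    if "m \<in> full_monomials n k" for m
  proof -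
    have "{\<kappa> \<in> proper_colourings V E. ?mon \<kappa> = m} = {\<kappa> \<in> ?S. ?mon \<kappa> = m}"
      using that full by (auto simp: surj_colourings_def)
    then show ?thesis by (simp add: chromatic_sym_def)
  qed
  then have "(\<Sum>m\<in>full_monomials n k. chromatic_sym V E m) =
      (\<Sum>m\<in>full_monomials n k. of_nat (card {\<kappa> \<in> ?S. ?mon \<kappa> = m}))"
    by simp
  also have "\<dots> = of_nat (\<Sum>m\<in>full_monomials n k. card {\<kappa> \<in> ?S. ?mon \<kappa> = m})"
    by simp
  also have "(\<Sum>m\<in>full_monomials n k. card {\<kappa> \<in> ?S. ?mon \<kappa> = m}) = card ?S"
  proof -
    have "?mon ` ?S \<subseteq> full_monomials n k"
      using full by (auto simp: surj_colourings_def)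
    then show ?thesis
      using sum.group[OF finite_surj_colourings[OF assms(1)] finite_full_monomials,
          where h = "\<lambda>_. 1 :: nat"] by simp
  qed
  finally show ?thesis .
qed

text \<open>
  The theorem of Greene and Zaslavsky on the linear coefficient of the chromatic polynomial. The
  sign \<open>-(-1)\<^sup>n\<close> is \<open>(-1)\<^bsup>n-1\<^esup>\<close>.
\<close>

lemma linear_coeff_chromatic_sym:
  assumes "simple_graph V E" "card V = n" "v \<in> V"
  shows "linear_coeff n (chromatic_sym V E) =
         - ((-1) ^ n) * of_nat (card {A \<in> orientations E. acyclic A \<and> sinks V E A = {v}})"
proof -
  have V: "finite V" and E: "induced E V = E"
    using assms(1) by (auto simp: simple_graph_def)
  have "linear_coeff n (chromatic_sym V E) =
      (\<Sum>k<card V. (-1) ^ k *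
            of_nat (card {\<kappa> \<in> surj_colourings V (induced E V) (Suc k). \<kappa> v = 1}))"
    unfolding linear_coeff_def sum_chromatic_sym_full[OF V assms(2)] assms(2)
  proof (intro sum.cong refl)
    fix k
    show "(-1) ^ k / of_nat (Suc k) * of_nat (card (surj_colourings V E (Suc k))) =
        (-1) ^ k * (of_nat (card {\<kappa> \<in> surj_colourings V (induced E V) (Suc k). \<kappa> v = 1}) :: rat)"
      unfolding card_surj_colourings_rooted[OF V assms(3), of E "Suc k", unfolded E] E of_nat_mult
      by (simp del: of_nat_Suc One_nat_def)
  qed
  also have "\<dots> = - ((-1) ^ card V) * (of_nat (card {A \<in> acyclic_orientations (induced E V).
              sinks V (induced E V) A = {v}}))"
    by (rule sum_signed_surj_colourings_rooted[OF V assms(3)])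
  finally show ?thesis
    unfolding E assms(2) by (simp add: acyclic_orientations_def conj_assoc)
qed

section \<open>Star forests\<close>

lemma card_star_forest_vertices: "card (star_forest_vertices p) = sum_list p"
  by (simp add: star_forest_vertices_def card_SigmaI sum_list_sum_nth atLeast0LessThan)

lemma star_forest_edge_iff:
  "{(i, j), (i', j')} \<in> star_forest_edges p \<longleftrightarrow>
     i = i' \<and> i < length p \<and> (j = 0 \<and> 0 < j' \<and> j' < p ! i \<or> j' = 0 \<and> 0 < j \<and> j < p ! i)"
  by (auto simp: star_forest_edges_def star_edges_def doubleton_eq_iff image_iff)

text \<open>
  If the centre of a star is not a sink, then some arc leads from it to a leaf, and that leaf has no
  other edge.
\<close>

lemma star_forest_sink_in_each_star:
  assumes A: "A \<in> orientations (star_forest_edges p)" and i: "i < length p" "0 < p ! i"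
  shows "\<exists>j. (i, j) \<in> sinks (star_forest_vertices p) (star_forest_edges p) A"
proof (cases "(i, 0) \<in> sinks (star_forest_vertices p) (star_forest_edges p) A")
  case False
  then obtain u where u: "{u, (i, 0)} \<in> star_forest_edges p" "(u, (i, 0)) \<notin> A"
    using i by (auto simp: sinks_def star_forest_vertices_def)
  then obtain j where j: "u = (i, j)" "0 < j" "j < p ! i"
    by (cases u) (auto simp: star_forest_edge_iff)
  have "((i, 0), (i, j)) \<in> A"
    using u j A by (auto simp: orientations_def)
  then have "(i, j) \<in> sinks (star_forest_vertices p) (star_forest_edges p) A"
    using i j by (auto simp: sinks_def star_forest_vertices_def star_forest_edge_iff)
  then show ?thesis ..
qed blast

lemma star_forest_no_unique_sink:
  assumes p: "\<forall>k\<in>set p. 0 < k" "length p \<ge> 2"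
  shows "{A \<in> orientations (star_forest_edges p). acyclic A \<and>
            sinks (star_forest_vertices p) (star_forest_edges p) A = {v}} = {}"
proof -
  have "0 < p ! 0" "0 < p ! 1"
    using p by (simp_all add: nth_mem del: length_greater_0_conv)
  then show ?thesis
    using star_forest_sink_in_each_star[of _ p 0] star_forest_sink_in_each_star[of _ p 1] p(2)
    by fastforce
qed

text \<open>
  The centre is a sink only if all edges point to it, and then no leaf is a sink.
\<close>

lemma star_unique_sink_centre:
  assumes "0 < n"
  shows "{A \<in> orientations (star_forest_edges [n]). acyclic A \<and>
            sinks (star_forest_vertices [n]) (star_forest_edges [n]) A = {(0, 0)}} =
         {{((0, j), (0, 0)) | j. 0 < j \<and> j < n}}" (is "?L = {?A}")
proof (intro equalityI subsetI)
  fix A assume "A \<in> ?L"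
  then have A: "A \<in> orientations (star_forest_edges [n])"
    and sink: "sinks (star_forest_vertices [n]) (star_forest_edges [n]) A = {(0, 0)}"
    by auto
  have into: "((0, j), (0, 0)) \<in> A" if "0 < j" "j < n" for j
  proof -
    have "(0, 0) \<in> sinks (star_forest_vertices [n]) (star_forest_edges [n]) A"
      by (simp add: sink)
    then show ?thesis
      using that unfolding sinks_def by (auto simp: star_forest_edge_iff)
  qed
  have "A = ?A"
  proof (rule set_eqI)
    fix e :: "(nat \<times> nat) \<times> nat \<times> nat"
    obtain i j i' j' where e: "e = ((i, j), (i', j'))" by (metis surj_pair)
    have "{(i, j), (i', j')} \<in> star_forest_edges [n] \<and> ((i', j'), (i, j)) \<notin> A" if "e \<in> A"
      using A that unfolding e orientations_def by blast
    then show "e \<in> A \<longleftrightarrow> e \<in> ?A"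
      using into unfolding e by (auto simp: star_forest_edge_iff)
  qed
  then show "A \<in> {?A}" by simp
next
  fix A assume "A \<in> {?A}"
  then have A: "A = ?A" by simp
  have "?A \<in> orientations (star_forest_edges [n])"
    by (auto simp: orientations_def star_forest_edge_iff)
  moreover have "acyclic ?A"
    using acyclic_Un_into[of "{}" ?A "{(0, 0)}"] by (auto simp: wf_acyclic)
  moreover have "sinks (star_forest_vertices [n]) (star_forest_edges [n]) ?A = {(0, 0)}"
  proof (intro equalityI subsetI)
    fix w assume w: "w \<in> sinks (star_forest_vertices [n]) (star_forest_edges [n]) ?A"
    then obtain j where j: "w = (0, j)" "j < n"
      by (auto simp: sinks_def star_forest_vertices_def)
    have "j = 0"
    proof (rule ccontr)
      assume "j \<noteq> 0"
      then have "{(0, 0), w} \<in> star_forest_edges [n]"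
        using j by (simp add: star_forest_edge_iff)
      then have "((0, 0), w) \<in> ?A"
        using w by (auto simp: sinks_def)
      then show False by auto
    qed
    then show "w \<in> {(0, 0)}" using j by simp
  qed (use assms in \<open>auto simp: sinks_def star_forest_vertices_def star_forest_edge_iff\<close>)
  ultimately show "A \<in> ?L" using A by simp
qed

text \<open>
  The value at a star forest may be computed with any root \<open>v\<close>; the centre of the first star suits both
  cases.
\<close>

lemma linear_coeff_star_sym:
  assumes p: "p \<in> partitions n" and n: "0 < n"
  shows "linear_coeff n (star_sym p) = (if p = [n] then - ((-1) ^ n) else 0)"
proof -
  have pos: "\<forall>k\<in>set p. 0 < k" and sum: "sum_list p = n"
    using p by (auto simp: partitions_def)
  then have "p \<noteq> []" using n by auto
  then have "(0, 0) \<in> star_forest_vertices p"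
    using pos by (auto simp: star_forest_vertices_def)
  then have lin: "linear_coeff n (star_sym p) = - ((-1) ^ n) *
      of_nat (card {A \<in> orientations (star_forest_edges p). acyclic A \<and>
        sinks (star_forest_vertices p) (star_forest_edges p) A = {(0, 0)}})"
    unfolding star_sym_def
    by (intro linear_coeff_chromatic_sym simple_graph_star_forest)
       (simp_all add: card_star_forest_vertices sum)
  show ?thesis
  proof (cases "length p \<ge> 2")
    case True
    then show ?thesis
      using lin star_forest_no_unique_sink[OF pos True] by auto
  next
    case False
    then have "p = [n]"
      using \<open>p \<noteq> []\<close> sum by (cases p) (auto simp: not_le)
    then show ?thesis
      using lin star_unique_sink_centre[OF n] by simp
  qed
qed

theorem theorem5p4:
  fixes V :: "'a set" and E :: "'a set set" and n :: nat
    and c :: "nat list \<Rightarrow> rat" and v :: 'a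
  assumes "simple_graph V E"
    and "card V = n"
    and "chromatic_sym V E = (\<lambda>m. \<Sum>p\<in>partitions n. c p * star_sym p m)"
    and "v \<in> V"
  shows "c [n] = of_nat (card {A \<in> orientations E. acyclic A \<and> sinks V E A = {v}})"
proof -
  have "finite V"
    using assms(1) by (simp add: simple_graph_def)
  then have n: "0 < n"
    using assms(2,4) card_gt_0_iff by blast
  have "- ((-1) ^ n) * of_nat (card {A \<in> orientations E. acyclic A \<and> sinks V E A = {v}}) =
      linear_coeff n (chromatic_sym V E)"
    using linear_coeff_chromatic_sym[OF assms(1,2,4)] by simp
  also have "\<dots> = (\<Sum>p\<in>partitions n. c p * linear_coeff n (star_sym p))"
    unfolding assms(3) by (rule linear_coeff_sum)
  also have "\<dots> = (\<Sum>p\<in>partitions n. if p = [n] then c p * - ((-1) ^ n) else 0)"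
    using n by (intro sum.cong) (auto simp: linear_coeff_star_sym)
  also have "\<dots> = - ((-1) ^ n) * c [n]"
    using n finite_partitions by (simp add: partitions_def mult.commute)
  finally show ?thesis by simp
qed

end
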